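(* Let $L_1,\dots,L_n$ and $R_1,\dots,R_n$ be strictly positive operators on a Hilbert space $\mathscr{H}$. Then $$\sum_{i=1}^{n}(R_i-L_i)\leq\sum_{i=1}^{n}R_i^{1/2}\log\left(R_i^{1/2}L_i^{-1}R_i^{1/2}\right)R_i^{1/2}.$$
   Context: An operator is strictly positive if it is positive and invertible; $X\le Y$ means $Y-X$ is positive. *)

theory Defs
  imports "HOL-Analysis.Analysis" "HOL-Computational_Algebra.Polynomial"
begin

text \<open>Complex Hilbert spaces, with the inner product linear in the second argument.\<close>

class complex_hilbert = banach +
  fixes scaleC :: "complex \<Rightarrow> 'a \<Rightarrow> 'a" (infixr "*\<^sub>C" 75)
    and cinner :: "'a \<Rightarrow> 'a \<Rightarrow> complex"
  assumes scaleC_add_right: "c *\<^sub>C (x + y) = c *\<^sub>C x + c *\<^sub>C y"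
    and scaleC_add_left: "(c + d) *\<^sub>C x = c *\<^sub>C x + d *\<^sub>C x"
    and scaleC_scaleC: "c *\<^sub>C (d *\<^sub>C x) = (c * d) *\<^sub>C x"
    and scaleC_of_real: "complex_of_real r *\<^sub>C x = r *\<^sub>R x"
    and cinner_commute: "cinner x y = cnj (cinner y x)"
    and cinner_add_right: "cinner x (y + z) = cinner x y + cinner x z"
    and cinner_scaleC_right: "cinner x (c *\<^sub>C y) = c * cinner x y"
    and cinner_ge_zero: "0 \<le> Re (cinner x x)"
    and cinner_eq_zero_iff: "cinner x x = 0 \<longleftrightarrow> x = 0"
    and norm_eq_sqrt_cinner: "norm x = sqrt (Re (cinner x x))"

instantiation complex :: complex_hilbert
begin

definition scaleC_complex :: "complex \<Rightarrow> complex \<Rightarrow> complex"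
  where "scaleC_complex c x = c * x"

definition cinner_complex :: "complex \<Rightarrow> complex \<Rightarrow> complex"
  where "cinner_complex x y = cnj x * y"

instance
  by standard
    (auto simp: scaleC_complex_def cinner_complex_def algebra_simps scaleR_conv_of_real
      cmod_def power2_eq_square)

end

text \<open>The library type \<open>'a \<Rightarrow>\<^sub>L 'a\<close> consists of the bounded real-linear maps; the bounded
  operators of the complex Hilbert space are its complex-linear elements.\<close>

definition complex_linear :: "('a::complex_hilbert \<Rightarrow>\<^sub>L 'a) \<Rightarrow> bool"
  where "complex_linear A \<longleftrightarrow> (\<forall>c x. blinfun_apply A (c *\<^sub>C x) = c *\<^sub>C blinfun_apply A x)"

definition positive_op :: "('a::complex_hilbert \<Rightarrow>\<^sub>L 'a) \<Rightarrow> bool"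
  where "positive_op A \<longleftrightarrow>
    complex_linear A \<and> (\<forall>x. cinner x (blinfun_apply A x) \<in> \<real>\<^sub>\<ge>\<^sub>0)"

definition op_le :: "('a::complex_hilbert \<Rightarrow>\<^sub>L 'a) \<Rightarrow> ('a \<Rightarrow>\<^sub>L 'a) \<Rightarrow> bool"
    (infix "\<le>\<^sub>o\<^sub>p" 50)
  where "X \<le>\<^sub>o\<^sub>p Y \<longleftrightarrow> positive_op (Y - X)"

definition is_op_inverse :: "('a::complex_hilbert \<Rightarrow>\<^sub>L 'a) \<Rightarrow> ('a \<Rightarrow>\<^sub>L 'a) \<Rightarrow> bool"
  where "is_op_inverse A B \<longleftrightarrow>
    complex_linear B \<and> A o\<^sub>L B = id_blinfun \<and> B o\<^sub>L A = id_blinfun"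

definition invertible_op :: "('a::complex_hilbert \<Rightarrow>\<^sub>L 'a) \<Rightarrow> bool"
  where "invertible_op A \<longleftrightarrow> (\<exists>B. is_op_inverse A B)"

definition op_inverse :: "('a::complex_hilbert \<Rightarrow>\<^sub>L 'a) \<Rightarrow> 'a \<Rightarrow>\<^sub>L 'a"
  where "op_inverse A = (THE B. is_op_inverse A B)"

definition strictly_positive_op :: "('a::complex_hilbert \<Rightarrow>\<^sub>L 'a) \<Rightarrow> bool"
  where "strictly_positive_op A \<longleftrightarrow> positive_op A \<and> invertible_op A"

lemma norm_scaleC: "norm (c *\<^sub>C x) = cmod c * norm (x::'a::complex_hilbert)"
proof -
  have "cinner (c *\<^sub>C x) (c *\<^sub>C x) = c * cnj (c * cinner x x)"
    by (metis cinner_commute cinner_scaleC_right)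
  also have "\<dots> = of_real ((cmod c)\<^sup>2) * cinner x x"
    using cinner_commute[of x x] by (simp add: complex_norm_square mult.assoc del: of_real_power)
  finally have "Re (cinner (c *\<^sub>C x) (c *\<^sub>C x)) = (cmod c)\<^sup>2 * Re (cinner x x)"
    by (simp only: Re_complex_of_real Im_complex_of_real times_complex.sel mult_zero_left diff_zero)
  then show ?thesis
    by (simp only: norm_eq_sqrt_cinner[of "c *\<^sub>C x"] norm_eq_sqrt_cinner[of x] real_sqrt_mult
      real_sqrt_abs abs_norm_cancel)
qed

lift_definition scalar_op :: "complex \<Rightarrow> 'a::complex_hilbert \<Rightarrow>\<^sub>L 'a" is "\<lambda>c x. c *\<^sub>C x"
proof
  fix c r and x y :: 'a
  show "c *\<^sub>C (x + y) = c *\<^sub>C x + c *\<^sub>C y"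
    by (rule scaleC_add_right)
  show "c *\<^sub>C (r *\<^sub>R x) = r *\<^sub>R (c *\<^sub>C x)"
    by (simp add: scaleC_of_real[symmetric] scaleC_scaleC mult.commute)
  show "\<exists>K. \<forall>x::'a. norm (c *\<^sub>C x) \<le> norm x * K"
    by (rule exI[of _ "cmod c"]) (simp add: norm_scaleC)
qed

definition op_spectrum :: "('a::complex_hilbert \<Rightarrow>\<^sub>L 'a) \<Rightarrow> complex set"
  where "op_spectrum A = {c. \<not> invertible_op (A - scalar_op c)}"

definition op_power :: "('a::complex_hilbert \<Rightarrow>\<^sub>L 'a) \<Rightarrow> nat \<Rightarrow> 'a \<Rightarrow>\<^sub>L 'a"
  where "op_power A k = ((\<lambda>B. A o\<^sub>L B) ^^ k) id_blinfun"

definition poly_op :: "real poly \<Rightarrow> ('a::complex_hilbert \<Rightarrow>\<^sub>L 'a) \<Rightarrow> 'a \<Rightarrow>\<^sub>L 'a"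
  where "poly_op p A = (\<Sum>k\<le>degree p. coeff p k *\<^sub>R op_power A k)"

text \<open>Continuous functional calculus \<open>f(A)\<close>, for \<open>A\<close> self-adjoint (so that the spectrum is real)
  and \<open>f\<close> real-valued and continuous on the spectrum: \<open>f(A)\<close> is the norm limit of \<open>p\<^sub>n(A)\<close> for
  real polynomials \<open>p\<^sub>n\<close> converging to \<open>f\<close> uniformly on the spectrum of \<open>A\<close>. For other
  \<open>A\<close> or \<open>f\<close> the value is not meaningful.\<close>

definition cfc :: "(real \<Rightarrow> real) \<Rightarrow> ('a::complex_hilbert \<Rightarrow>\<^sub>L 'a) \<Rightarrow> 'a \<Rightarrow>\<^sub>L 'a"
  where "cfc f A = (THE B. \<exists>p.
    uniform_limit {t. complex_of_real t \<in> op_spectrum A} (\<lambda>n. poly (p n)) f sequentially \<and>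
    (\<lambda>n. poly_op (p n) A) \<longlonglongrightarrow> B)"

abbreviation op_sqrt :: "('a::complex_hilbert \<Rightarrow>\<^sub>L 'a) \<Rightarrow> 'a \<Rightarrow>\<^sub>L 'a"
  where "op_sqrt \<equiv> cfc sqrt"

abbreviation op_log :: "('a::complex_hilbert \<Rightarrow>\<^sub>L 'a) \<Rightarrow> 'a \<Rightarrow>\<^sub>L 'a"
  where "op_log \<equiv> cfc ln"

end

theory Submission
  imports Defs "HOL-Computational_Algebra.Fundamental_Theorem_Algebra"
begin

text \<open>
  The inequality holds for each summand. Write \<open>S = R\<^bsup>1/2\<^esup>\<close> and
  \<open>T = S L\<^bsup>-1\<^esup> S\<close>, which is again strictly positive. The scalar inequality
  \<open>ln t \<ge> 1 - 1 / t\<close> on the spectrum of \<open>T\<close> gives \<open>log T \<ge> 1 - T\<^bsup>-1\<^esup>\<close>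
  (lemma \<open>op_log_lower_bound\<close>), and conjugating by \<open>S\<close> turns this into
  \<open>S (log T) S \<ge> S S - S S\<^bsup>-1\<^esup> L S\<^bsup>-1\<^esup> S = R - L\<close>
  (lemma \<open>diff_le_relative_entropy\<close>).

  The work lies in the continuous functional calculus behind the square root and the logarithm.
  Everything about it follows from one fact, \<open>form_nonneg_poly_op\<close>: for self-adjoint \<open>A\<close>, a
  real polynomial that is nonnegative on the real spectrum of \<open>A\<close> yields a positive operator.
  Applied to \<open>M\<^sup>2 - p\<^sup>2\<close> it bounds the norm of \<open>p(A)\<close> by the supremum of \<open>p\<close> on the
  spectrum, so that \<open>f(A)\<close> exists and does not depend on the approximating polynomials
  (\<open>poly_op_tendsto_cfc\<close>); sums, products and positivity then pass to the limit.

  That fact is reduced to an invertibility question. If the numerical range of a self-adjoint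
  \<open>B\<close> has infimum \<open>m\<close>, then \<open>B - m\<close> is positive but not coercive, and a positive
  invertible operator is coercive (\<open>coercive_if_invertible\<close>); hence \<open>m\<close> is in the
  spectrum. For \<open>B = p(A)\<close> one needs that \<open>q(A)\<close> is invertible when the real polynomial \<open>q\<close>
  has no zero in the spectrum (\<open>invertible_poly_op\<close>). The linear and quadratic real factors of
  \<open>q\<close> are treated one at a time; those without real zeros give
  \<open>(A - a)\<^sup>2 + b\<^sup>2\<close> with \<open>b \<noteq> 0\<close>, which is invertible by a Lax-Milgram argument
  (\<open>invertible_op_if_coercive\<close>).
\<close>

section \<open>The real part of the inner product\<close>

text \<open>For complex-linear operators symmetry and positivity can be read off from the real part of
  the inner product alone (lemma \<open>positive_op_iff\<close>), which keeps complex conjugates out of all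
  later computations.\<close>

definition rinner :: "'a::complex_hilbert \<Rightarrow> 'a \<Rightarrow> real"
  where "rinner x y = Re (cinner x y)"

lemma rinner_commute: "rinner x y = rinner y x"
  unfolding rinner_def by (metis cinner_commute cnj.sel(1))

lemma rinner_add_right: "rinner x (y + z) = rinner x y + rinner x z"
  by (simp add: rinner_def cinner_add_right)

lemma rinner_add_left: "rinner (x + y) z = rinner x z + rinner y z"
  by (metis rinner_add_right rinner_commute)

lemma rinner_scaleR_right: "rinner x (r *\<^sub>R y) = r * rinner x y"
  by (simp add: rinner_def scaleC_of_real[symmetric] cinner_scaleC_right)

lemma rinner_scaleR_left: "rinner (r *\<^sub>R x) y = r * rinner x y"
  by (metis rinner_scaleR_right rinner_commute)

lemma rinner_minus_right: "rinner x (- y) = - rinner x y"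
  using rinner_scaleR_right[of x "-1" y] by simp

lemma rinner_diff_right: "rinner x (y - z) = rinner x y - rinner x z"
  using rinner_add_right[of x y "-z"] by (simp add: rinner_minus_right)

lemma rinner_diff_left: "rinner (x - y) z = rinner x z - rinner y z"
  by (metis rinner_diff_right rinner_commute)

lemma rinner_zero_right [simp]: "rinner x 0 = 0"
  using rinner_diff_right[of x 0 0] by simp

lemmas rinner_simps = rinner_add_right rinner_add_left rinner_scaleR_right rinner_scaleR_left
  rinner_minus_right rinner_diff_right rinner_diff_left

lemma rinner_self: "rinner x x = (norm x)\<^sup>2"
  unfolding rinner_def norm_eq_sqrt_cinner by (simp add: cinner_ge_zero)

definition rsym :: "('a::complex_hilbert \<Rightarrow>\<^sub>L 'a) \<Rightarrow> bool"
  where "rsym A \<longleftrightarrow> (\<forall>x y. rinner (A x) y = rinner x (A y))"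

definition form_nonneg :: "('a::complex_hilbert \<Rightarrow>\<^sub>L 'a) \<Rightarrow> bool"
  where "form_nonneg A \<longleftrightarrow> (\<forall>x. 0 \<le> rinner x (A x))"

lemma rsymD: "rsym A \<Longrightarrow> rinner (A x) y = rinner x (A y)"
  by (simp add: rsym_def)

text \<open>The real quadratic \<open>t \<mapsto> \<langle>x + t y, C (x + t y)\<rangle>\<close> is nonnegative, so its discriminant is
  not positive. With the identity for \<open>C\<close> this is the usual Cauchy-Schwarz inequality; a general
  \<open>C\<close> is needed for \<open>coercive_if_invertible\<close>.\<close>

lemma Cauchy_Schwarz_form:
  assumes "rsym C" "form_nonneg C"
  shows "(rinner x (C y))\<^sup>2 \<le> rinner x (C x) * rinner y (C y)"
proof -
  define a b c where "a = rinner x (C x)" and "b = rinner x (C y)" and "c = rinner y (C y)"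
  have q: "0 \<le> a + 2 * t * b + t\<^sup>2 * c" for t
  proof -
    have "0 \<le> rinner (x + t *\<^sub>R y) (C (x + t *\<^sub>R y))"
      using assms(2) by (simp add: form_nonneg_def)
    moreover have "rinner y (C x) = b"
      unfolding b_def using rsymD[OF assms(1), of y x] rinner_commute by metis
    ultimately show ?thesis
      by (simp add: rinner_simps blinfun.add_right blinfun.scaleR_right a_def b_def c_def
          power2_eq_square algebra_simps)
  qed
  have "b\<^sup>2 \<le> a * c"
  proof (cases "c = 0")
    case True
    \<comment> \<open>Then the quadratic is affine in \<open>t\<close>; a nonzero slope would make it equal to \<open>-1\<close> somewhere.\<close>
    have "b = 0"
    proof (rule ccontr)
      assume "b \<noteq> 0"
      then show False using q[of "- (a + 1) / (2 * b)"] True by (simp add: field_simps)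
    qed
    then show ?thesis using True by simp
  next
    case False
    then have c: "c > 0" using assms(2) by (simp add: c_def form_nonneg_def order_less_le)
    have "0 \<le> a - b\<^sup>2 / c" using q[of "- b / c"] c
      by (simp add: power2_eq_square field_simps)
    then show ?thesis using c by (simp add: field_simps)
  qed
  then show ?thesis by (simp add: a_def b_def c_def)
qed

lemma rinner_Cauchy_Schwarz: "\<bar>rinner x y\<bar> \<le> norm x * norm y"
proof -
  have "(rinner x y)\<^sup>2 \<le> (norm x * norm y)\<^sup>2"
    using Cauchy_Schwarz_form[of "id_blinfun" x y]
    by (simp add: rsym_def form_nonneg_def rinner_self power_mult_distrib)
  then show ?thesis
    by (metis abs_le_square_iff abs_mult abs_norm_cancel)
qed

lemma bounded_bilinear_rinner: "bounded_bilinear rinner"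
proof
  show "\<exists>K. \<forall>a b. norm (rinner a b) \<le> norm a * norm b * K"
    by (rule exI[of _ 1]) (use rinner_Cauchy_Schwarz in auto)
qed (simp_all add: rinner_simps)

lemmas tendsto_rinner = bounded_bilinear.tendsto[OF bounded_bilinear_rinner]

lemma cinner_imaginary_left: "cinner (\<i> *\<^sub>C u) v = - \<i> * cinner u v"
  by (metis cinner_commute cinner_scaleC_right complex_cnj_i complex_cnj_mult)

text \<open>The imaginary part of \<open>\<langle>x, A x\<rangle>\<close> is the real part of \<open>\<langle>\<i> x, A x\<rangle>\<close>; moving \<open>A\<close> to the
  left and taking conjugates shows that it equals its own negative.\<close>

lemma cinner_real_if_rsym:
  assumes "complex_linear A" "rsym A"
  shows "Im (cinner x (A x)) = 0"
proof -
  have "rinner (A (\<i> *\<^sub>C x)) x = rinner (\<i> *\<^sub>C x) (A x)"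
    using assms(2) by (rule rsymD)
  moreover have "rinner (A (\<i> *\<^sub>C x)) x = Im (cinner (A x) x)"
    using assms(1) by (simp add: complex_linear_def rinner_def cinner_imaginary_left)
  moreover have "rinner (\<i> *\<^sub>C x) (A x) = Im (cinner x (A x))"
    by (simp add: rinner_def cinner_imaginary_left)
  moreover have "Im (cinner (A x) x) = - Im (cinner x (A x))"
    by (metis cinner_commute cnj.sel(2))
  ultimately show ?thesis by linarith
qed

text \<open>Polarization: the vector \<open>x + \<i> y\<close> is enough, since only the real part of the sesquilinear
  form has to be symmetric.\<close>

lemma rsym_if_positive:
  assumes "positive_op A"
  shows "rsym A"
proof -
  have lin: "A (c *\<^sub>C x) = c *\<^sub>C A x" for c x
    using assms by (simp add: positive_op_def complex_linear_def)
  have real: "Im (cinner x (A x)) = 0" for x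
    using assms by (simp add: positive_op_def complex_nonneg_Reals_iff)
  have ladd: "cinner (u + v) w = cinner u w + cinner v w" for u v w :: 'a
    by (metis cinner_commute cinner_add_right complex_cnj_add)
  have "rinner (A x) y = rinner x (A y)" for x y
  proof -
    have "Im (cinner (x + \<i> *\<^sub>C y) (A (x + \<i> *\<^sub>C y))) = 0" by (rule real)
    then have "Re (cinner x (A y)) = Re (cinner y (A x))"
      using real[of x] real[of y]
      by (simp add: ladd cinner_imaginary_left lin cinner_add_right cinner_scaleC_right blinfun.add_right
          algebra_simps)
    then show ?thesis by (metis rinner_def rinner_commute)
  qed
  then show ?thesis by (simp add: rsym_def)
qed

lemma positive_op_iff: "positive_op A \<longleftrightarrow> complex_linear A \<and> rsym A \<and> form_nonneg A"
  using rsym_if_positive[of A] cinner_real_if_rsym[of A]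
  by (auto simp: positive_op_def form_nonneg_def rinner_def complex_nonneg_Reals_iff)

section \<open>Self-adjoint operators and invertibility\<close>

definition self_adjoint :: "('a::complex_hilbert \<Rightarrow>\<^sub>L 'a) \<Rightarrow> bool"
  where "self_adjoint A \<longleftrightarrow> complex_linear A \<and> rsym A"

lemma complex_linear_id: "complex_linear id_blinfun"
  by (simp add: complex_linear_def)

lemma complex_linear_scaleR: "complex_linear A \<Longrightarrow> complex_linear (r *\<^sub>R A)"
  by (simp add: complex_linear_def blinfun.scaleR_left scaleC_of_real[symmetric] scaleC_scaleC
      mult.commute)

lemma complex_linear_add: "complex_linear A \<Longrightarrow> complex_linear B \<Longrightarrow> complex_linear (A + B)"
  by (simp add: complex_linear_def blinfun.add_left scaleC_add_right)

lemma complex_linear_diff: "complex_linear A \<Longrightarrow> complex_linear B \<Longrightarrow> complex_linear (A - B)"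
  using complex_linear_add[of A "(-1) *\<^sub>R B"] complex_linear_scaleR[of B "-1"] by simp

lemma complex_linear_compose:
  "complex_linear A \<Longrightarrow> complex_linear B \<Longrightarrow> complex_linear (A o\<^sub>L B)"
  by (simp add: complex_linear_def)

lemma self_adjoint_id: "self_adjoint id_blinfun"
  by (simp add: self_adjoint_def complex_linear_id rsym_def)

lemma self_adjoint_scaleR: "self_adjoint A \<Longrightarrow> self_adjoint (r *\<^sub>R A)"
  by (simp add: self_adjoint_def complex_linear_scaleR rsym_def blinfun.scaleR_left rinner_simps)

lemma self_adjoint_add: "self_adjoint A \<Longrightarrow> self_adjoint B \<Longrightarrow> self_adjoint (A + B)"
  by (simp add: self_adjoint_def complex_linear_add rsym_def blinfun.add_left rinner_simps)

lemma self_adjoint_diff: "self_adjoint A \<Longrightarrow> self_adjoint B \<Longrightarrow> self_adjoint (A - B)"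
  by (simp add: self_adjoint_def complex_linear_diff rsym_def blinfun.diff_left rinner_simps)

lemma self_adjoint_sandwich:
  "self_adjoint A \<Longrightarrow> self_adjoint B \<Longrightarrow> self_adjoint (A o\<^sub>L B o\<^sub>L A)"
  by (simp add: self_adjoint_def complex_linear_compose rsym_def)

lemma self_adjoint_limit:
  assumes "\<And>n. self_adjoint (A n)" "A \<longlonglongrightarrow> B"
  shows "self_adjoint B"
proof -
  have A: "(\<lambda>n. A n x) \<longlonglongrightarrow> B x" for x
    using assms(2) by (intro tendsto_intros)
  have "B (c *\<^sub>C x) = c *\<^sub>C B x" for c x
  proof (rule LIMSEQ_unique[OF A])
    have "(\<lambda>n. scalar_op c (A n x)) \<longlonglongrightarrow> scalar_op c (B x)"
      by (intro tendsto_intros A)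
    then show "(\<lambda>n. A n (c *\<^sub>C x)) \<longlonglongrightarrow> c *\<^sub>C B x"
      using assms(1) by (simp add: scalar_op.rep_eq self_adjoint_def complex_linear_def)
  qed
  moreover have "rinner (B x) y = rinner x (B y)" for x y
  proof (rule LIMSEQ_unique)
    show "(\<lambda>n. rinner (A n x) y) \<longlonglongrightarrow> rinner (B x) y"
      by (intro tendsto_rinner A tendsto_const)
    have "(\<lambda>n. rinner x (A n y)) \<longlonglongrightarrow> rinner x (B y)"
      by (intro tendsto_rinner A tendsto_const)
    then show "(\<lambda>n. rinner (A n x) y) \<longlonglongrightarrow> rinner x (B y)"
      using assms(1) by (simp add: self_adjoint_def rsym_def)
  qed
  ultimately show ?thesis
    by (simp add: self_adjoint_def complex_linear_def rsym_def)
qed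

lemma is_op_inverseI:
  assumes "complex_linear A" "A o\<^sub>L B = id_blinfun" "B o\<^sub>L A = id_blinfun"
  shows "is_op_inverse A B"
proof -
  have AB: "A (B x) = x" and BA: "B (A x) = x" for x
    using assms(2,3) by (metis blinfun_apply_blinfun_compose blinfun_apply_id_blinfun)+
  have "B (c *\<^sub>C x) = c *\<^sub>C B x" for c x
    using assms(1) by (metis AB BA complex_linear_def)
  with assms(2,3) show ?thesis by (simp add: is_op_inverse_def complex_linear_def)
qed

lemma is_op_inverse_apply:
  assumes "is_op_inverse A B"
  shows "A (B x) = x" "B (A x) = x"
  using assms unfolding is_op_inverse_def
  by (metis blinfun_apply_blinfun_compose blinfun_apply_id_blinfun)+

lemma is_op_inverse_iff:
  "is_op_inverse A B \<longleftrightarrow> complex_linear B \<and> (\<forall>x. A (B x) = x) \<and> (\<forall>x. B (A x) = x)"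
  using is_op_inverse_apply[of A B]
  by (auto simp: is_op_inverse_def intro!: blinfun_eqI)

lemma is_op_inverse_unique:
  assumes "is_op_inverse A B" "is_op_inverse A C"
  shows "B = C"
  using assms by (metis is_op_inverse_apply blinfun_eqI)

lemma op_inverse_eqI: "is_op_inverse A B \<Longrightarrow> op_inverse A = B"
  unfolding op_inverse_def by (blast intro: is_op_inverse_unique)

lemma is_op_inverse_op_inverse: "invertible_op A \<Longrightarrow> is_op_inverse A (op_inverse A)"
  using op_inverse_eqI by (auto simp: invertible_op_def)

lemma is_op_inverse_compose:
  assumes "is_op_inverse A A'" "is_op_inverse B B'"
  shows "is_op_inverse (A o\<^sub>L B) (B' o\<^sub>L A')"
  using assms by (simp add: is_op_inverse_iff complex_linear_compose)

lemma is_op_inverse_sym: "complex_linear A \<Longrightarrow> is_op_inverse A B \<Longrightarrow> is_op_inverse B A"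
  by (simp add: is_op_inverse_def)

lemma invertible_op_compose:
  "invertible_op A \<Longrightarrow> invertible_op B \<Longrightarrow> invertible_op (A o\<^sub>L B)"
  by (meson invertible_op_def is_op_inverse_compose)

lemma invertible_op_scaleR:
  assumes "r \<noteq> 0" "invertible_op A"
  shows "invertible_op (r *\<^sub>R A)"
proof -
  obtain B where B: "is_op_inverse A B" using assms(2) by (auto simp: invertible_op_def)
  have "is_op_inverse (r *\<^sub>R A) ((1 / r) *\<^sub>R B)"
    using B assms(1) by (simp add: is_op_inverse_iff complex_linear_scaleR blinfun.scaleR_left
      blinfun.scaleR_right)
  then show ?thesis by (auto simp: invertible_op_def)
qed

lemma invertible_op_id: "invertible_op id_blinfun"
  unfolding invertible_op_def is_op_inverse_iff
  by (rule exI[of _ id_blinfun]) (simp add: complex_linear_id)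

text \<open>Lax-Milgram: for a small step \<open>\<tau>\<close> the map \<open>x \<mapsto> x - \<tau> (A x - y)\<close> is a contraction, and its
  fixed point solves \<open>A x = y\<close>; coercivity also bounds the inverse.\<close>

lemma invertible_op_if_coercive:
  assumes lin: "complex_linear A" and "c > 0" and coercive: "\<And>x. c * (norm x)\<^sup>2 \<le> rinner x (A x)"
  shows "invertible_op A"
proof -
  have lower: "c * norm x \<le> norm (A x)" for x
  proof (cases "x = 0")
    case False
    have "norm x * (c * norm x) \<le> norm x * norm (A x)"
      using coercive[of x] rinner_Cauchy_Schwarz[of x "A x"]
      by (simp add: power2_eq_square algebra_simps)
    then show ?thesis using False by simp
  qed simp
  define M where "M = norm A + c + 1"
  have M: "c < M" "M > 0" using \<open>c > 0\<close> norm_ge_zero[of A] unfolding M_def by linarith+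
  have upper: "norm (A x) \<le> M * norm x" for x
  proof -
    have "norm (A x) \<le> norm A * norm x" by (rule norm_blinfun)
    also have "\<dots> \<le> M * norm x" unfolding M_def
      using \<open>c > 0\<close> by (intro mult_right_mono) auto
    finally show ?thesis .
  qed
  \<comment> \<open>This \<open>\<tau>\<close> minimizes the bound \<open>1 - 2 \<tau> c + \<tau>\<^sup>2 M\<^sup>2\<close> for the squared contraction factor; the
    summand \<open>1\<close> in \<open>M\<close> gives \<open>c < M\<close>, so that the minimum is positive.\<close>
  define \<tau> where "\<tau> = c / M\<^sup>2"
  define k where "k = sqrt (1 - (c / M)\<^sup>2)"
  have cM: "0 < (c / M)\<^sup>2" "(c / M)\<^sup>2 < 1"
    using M \<open>c > 0\<close> by (auto simp: power_less_one_iff abs_square_less_1)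
  have k: "0 \<le> k" "k < 1" "k\<^sup>2 = 1 - (c / M)\<^sup>2" using cM by (auto simp: k_def)
  have contr: "norm (x - \<tau> *\<^sub>R A x) \<le> k * norm x" for x
  proof -
    have "(norm (x - \<tau> *\<^sub>R A x))\<^sup>2 = (norm x)\<^sup>2 - 2 * \<tau> * rinner x (A x) + \<tau>\<^sup>2 * (norm (A x))\<^sup>2"
      unfolding rinner_self[symmetric]
      by (simp add: rinner_simps rinner_commute[of "A x" x] power2_eq_square algebra_simps)
    also have "\<dots> \<le> (norm x)\<^sup>2 - 2 * \<tau> * (c * (norm x)\<^sup>2) + \<tau>\<^sup>2 * (M * norm x)\<^sup>2"
      using coercive[of x] upper[of x] M \<open>c > 0\<close>
      by (intro add_mono diff_mono mult_left_mono power_mono) (auto simp: \<tau>_def)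
    also have "\<dots> = k\<^sup>2 * (norm x)\<^sup>2"
      using M \<open>c > 0\<close> unfolding k(3) \<tau>_def by (simp add: field_simps power2_eq_square)
    finally have "(norm (x - \<tau> *\<^sub>R A x))\<^sup>2 \<le> (k * norm x)\<^sup>2" by (simp only: power_mult_distrib)
    then show ?thesis by (rule power2_le_imp_le) (simp add: k(1))
  qed
  have "\<exists>x. A x = y" for y
  proof -
    define f where "f x = x - \<tau> *\<^sub>R (A x - y)" for x
    have "dist (f u) (f v) \<le> k * dist u v" for u v
      using contr[of "u - v"] by (simp add: f_def dist_norm blinfun.diff_right algebra_simps)
    then have "\<exists>!x. f x = x" using k by (intro banach_fix_type) auto
    then obtain x where "f x = x" by blast
    then have "A x = y" using M \<open>c > 0\<close> by (simp add: f_def \<tau>_def)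
    then show ?thesis ..
  qed
  then obtain g where g: "\<And>y. A (g y) = y" by metis
  have inj: "x = y" if "A x = A y" for x y
    using lower[of "x - y"] that \<open>c > 0\<close> by (simp add: blinfun.diff_right mult_le_0_iff)
  have "bounded_linear g"
  proof (rule bounded_linear_intro[of _ "1 / c"])
    show "g (x + y) = g x + g y" for x y by (rule inj) (simp add: g blinfun.add_right)
    show "g (r *\<^sub>R x) = r *\<^sub>R g x" for r x by (rule inj) (simp add: g blinfun.scaleR_right)
    show "norm (g x) \<le> norm x * (1 / c)" for x
      using lower[of "g x"] \<open>c > 0\<close> by (simp add: g field_simps)
  qed
  then have B: "blinfun_apply (Blinfun g) = g" by (rule bounded_linear_Blinfun_apply)
  have "is_op_inverse A (Blinfun g)"
    using lin by (intro is_op_inverseI blinfun_eqI) (simp_all add: B g inj)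
  then show ?thesis by (auto simp: invertible_op_def)
qed

text \<open>Cauchy-Schwarz for the form of \<open>A\<close>, applied to \<open>x\<close> and \<open>A\<^bsup>-1\<^esup> x\<close>, gives
  \<open>\<parallel>x\<parallel>\<^sup>4 \<le> \<langle>x, A x\<rangle> \<langle>A\<^bsup>-1\<^esup> x, x\<rangle>\<close>, and the last factor is at most \<open>\<parallel>A\<^bsup>-1\<^esup>\<parallel> \<parallel>x\<parallel>\<^sup>2\<close>.\<close>

lemma coercive_if_invertible:
  assumes "rsym A" "form_nonneg A" "invertible_op A"
  obtains c where "c > 0" "\<And>x. c * (norm x)\<^sup>2 \<le> rinner x (A x)"
proof -
  obtain B where B: "is_op_inverse A B" using assms(3) by (auto simp: invertible_op_def)
  \<comment> \<open>Adding \<open>1\<close> avoids a division by zero on the zero space.\<close>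
  define c where "c = 1 / (norm B + 1)"
  have c: "c > 0" by (simp add: c_def add_nonneg_pos)
  have "c * (norm x)\<^sup>2 \<le> rinner x (A x)" for x
  proof (cases "x = 0")
    case False
    have "((norm x)\<^sup>2)\<^sup>2 = (rinner x (A (B x)))\<^sup>2"
      using B by (simp add: is_op_inverse_apply rinner_self)
    also have "\<dots> \<le> rinner x (A x) * rinner (B x) (A (B x))"
      using assms by (intro Cauchy_Schwarz_form)
    also have "\<dots> \<le> rinner x (A x) * ((norm B + 1) * (norm x)\<^sup>2)"
    proof (rule mult_left_mono)
      have "rinner (B x) (A (B x)) \<le> norm (B x) * norm x"
        using B rinner_Cauchy_Schwarz[of "B x" x] by (simp add: is_op_inverse_apply)
      also have "\<dots> \<le> (norm B * norm x) * norm x"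
        by (intro mult_right_mono norm_blinfun) auto
      also have "\<dots> \<le> (norm B + 1) * (norm x)\<^sup>2"
        by (simp add: power2_eq_square algebra_simps)
      finally show "rinner (B x) (A (B x)) \<le> (norm B + 1) * (norm x)\<^sup>2" .
      show "0 \<le> rinner x (A x)" using assms(2) by (simp add: form_nonneg_def)
    qed
    finally have "(norm x)\<^sup>2 * (norm x)\<^sup>2 \<le> (rinner x (A x) * (norm B + 1)) * (norm x)\<^sup>2"
      by (simp add: power2_eq_square algebra_simps)
    then have "(norm x)\<^sup>2 \<le> rinner x (A x) * (norm B + 1)"
      by (rule mult_right_le_imp_le) (use False in simp)
    then show ?thesis
      by (simp add: c_def pos_divide_le_eq add_nonneg_pos)
  qed simp
  with c show ?thesis by (rule that)
qed

section \<open>Polynomials of an operator\<close>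

lemma op_power_Suc: "op_power A (Suc k) = A o\<^sub>L op_power A k"
  by (simp add: op_power_def)

lemma poly_op_eq_sum:
  assumes "degree p \<le> N"
  shows "poly_op p A = (\<Sum>k\<le>N. coeff p k *\<^sub>R op_power A k)"
  unfolding poly_op_def using assms
  by (intro sum.mono_neutral_left) (auto simp: coeff_eq_0)

lemma blinfun_compose_sum_right: "A o\<^sub>L (\<Sum>k\<in>K. F k) = (\<Sum>k\<in>K. A o\<^sub>L F k)"
  by (rule bounded_bilinear.sum_right[OF bounded_bilinear_blinfun_compose])

text \<open>The Horner recursion, which makes the algebra of \<open>poly_op\<close> accessible to induction on
  polynomials.\<close>

lemma poly_op_pCons: "poly_op (pCons a p) A = a *\<^sub>R id_blinfun + (A o\<^sub>L poly_op p A)"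
proof -
  have "poly_op (pCons a p) A = (\<Sum>k\<le>Suc (degree p). coeff (pCons a p) k *\<^sub>R op_power A k)"
    by (rule poly_op_eq_sum) (rule degree_pCons_le)
  also have "\<dots> = a *\<^sub>R op_power A 0 + (\<Sum>k\<le>degree p. coeff p k *\<^sub>R op_power A (Suc k))"
    by (subst sum.atMost_Suc_shift) simp
  also have "(\<Sum>k\<le>degree p. coeff p k *\<^sub>R op_power A (Suc k)) = A o\<^sub>L poly_op p A"
    unfolding poly_op_def blinfun_compose_sum_right op_power_Suc
    by (simp add: bounded_bilinear.scaleR_right[OF bounded_bilinear_blinfun_compose])
  finally show ?thesis by (simp add: op_power_def)
qed

lemma poly_op_0 [simp]: "poly_op 0 A = 0"
  by (simp add: poly_op_def)

lemma poly_op_pCons_apply: "poly_op (pCons a p) A x = a *\<^sub>R x + A (poly_op p A x)"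
  by (simp add: poly_op_pCons blinfun.add_left blinfun.scaleR_left)

lemma poly_op_add: "poly_op (p + q) A = poly_op p A + poly_op q A"
proof (rule blinfun_eqI)
  show "poly_op (p + q) A x = (poly_op p A + poly_op q A) x" for x
    by (induction p q rule: poly_induct2)
      (simp_all add: poly_op_pCons_apply blinfun.add_left blinfun.add_right scaleR_add_left)
qed

lemma poly_op_smult: "poly_op (smult r p) A = r *\<^sub>R poly_op p A"
proof (rule blinfun_eqI)
  show "poly_op (smult r p) A x = (r *\<^sub>R poly_op p A) x" for x
    by (induction p) (simp_all add: poly_op_pCons_apply blinfun.scaleR_left blinfun.scaleR_right
      scaleR_add_right)
qed

lemma poly_op_diff: "poly_op (p - q) A = poly_op p A - poly_op q A"
  by (metis poly_op_add add_diff_cancel_right' diff_add_cancel)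

lemma poly_op_mult: "poly_op (p * q) A = poly_op p A o\<^sub>L poly_op q A"
proof (rule blinfun_eqI)
  show "poly_op (p * q) A x = (poly_op p A o\<^sub>L poly_op q A) x" for x
    by (induction p) (simp_all add: poly_op_add poly_op_smult poly_op_pCons_apply blinfun.add_left
      blinfun.scaleR_left)
qed

lemma poly_op_const: "poly_op [:a:] A = a *\<^sub>R id_blinfun"
  by (rule blinfun_eqI) (simp add: poly_op_pCons_apply blinfun.scaleR_left)

lemma poly_op_linear: "poly_op [:a, 1:] A = a *\<^sub>R id_blinfun + A"
  by (rule blinfun_eqI) (simp add: poly_op_pCons_apply blinfun.scaleR_left blinfun.add_left)

lemma poly_op_commute: "A (poly_op p A x) = poly_op p A (A x)"
  by (induction p arbitrary: x)
    (simp_all add: poly_op_pCons_apply blinfun.add_right blinfun.scaleR_right)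

lemma self_adjoint_poly_op:
  assumes "self_adjoint A"
  shows "self_adjoint (poly_op p A)"
proof (induction p)
  case 0
  show ?case using self_adjoint_scaleR[OF self_adjoint_id, of 0] by simp
next
  case (pCons a p)
  have "rsym (A o\<^sub>L poly_op p A)"
    using assms pCons.IH by (simp add: self_adjoint_def rsym_def poly_op_commute)
  then show ?case unfolding poly_op_pCons
    using assms pCons.IH
    by (intro self_adjoint_add self_adjoint_scaleR self_adjoint_id)
      (simp add: self_adjoint_def complex_linear_compose)
qed

section \<open>Spectral mapping and positivity\<close>

definition real_spectrum :: "('a::complex_hilbert \<Rightarrow>\<^sub>L 'a) \<Rightarrow> real set"
  where "real_spectrum A = {t. complex_of_real t \<in> op_spectrum A}"

lemma real_spectrum_iff: "t \<in> real_spectrum A \<longleftrightarrow> \<not> invertible_op (A - t *\<^sub>R id_blinfun)"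
proof -
  have "scalar_op (complex_of_real t) = (t *\<^sub>R id_blinfun :: 'a \<Rightarrow>\<^sub>L 'a)"
    by (rule blinfun_eqI) (simp add: scalar_op.rep_eq scaleC_of_real blinfun.scaleR_left)
  then show ?thesis by (simp add: real_spectrum_def op_spectrum_def)
qed

lemma real_spectrum_ge:
  assumes "self_adjoint A" "\<And>x. c * (norm x)\<^sup>2 \<le> rinner x (A x)" "t \<in> real_spectrum A"
  shows "c \<le> t"
proof (rule ccontr)
  assume "\<not> c \<le> t"
  have "invertible_op (A - t *\<^sub>R id_blinfun)"
  proof (rule invertible_op_if_coercive)
    show "complex_linear (A - t *\<^sub>R id_blinfun)"
      using assms(1) by (simp add: self_adjoint_def complex_linear_diff complex_linear_scaleR
        complex_linear_id)
    show "c - t > 0" using \<open>\<not> c \<le> t\<close> by simp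
    show "(c - t) * (norm x)\<^sup>2 \<le> rinner x ((A - t *\<^sub>R id_blinfun) x)" for x
      using assms(2)[of x]
      by (simp add: blinfun.diff_left blinfun.scaleR_left rinner_simps rinner_self algebra_simps)
  qed
  with assms(3) show False by (simp add: real_spectrum_iff)
qed

lemma real_spectrum_le_norm:
  assumes "self_adjoint A" "t \<in> real_spectrum A"
  shows "t \<le> norm A"
proof -
  have mem: "- t \<in> real_spectrum ((-1) *\<^sub>R A)"
    using assms(2) invertible_op_scaleR[of "-1" "(-1) *\<^sub>R A - (-t) *\<^sub>R id_blinfun"]
    by (auto simp: real_spectrum_iff)
  have bound: "- norm A * (norm x)\<^sup>2 \<le> rinner x (((-1) *\<^sub>R A) x)" for x
  proof -
    have "rinner x (A x) \<le> norm x * (norm A * norm x)"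
      by (rule order_trans[OF _ mult_left_mono[OF norm_blinfun]])
        (use rinner_Cauchy_Schwarz[of x "A x"] in auto)
    then show ?thesis
      by (simp add: blinfun.minus_left rinner_simps power2_eq_square algebra_simps)
  qed
  have "- norm A \<le> - t"
    by (rule real_spectrum_ge[OF self_adjoint_scaleR[OF assms(1)] bound mem])
  then show ?thesis by simp
qed

text \<open>One half of the spectral mapping theorem. Induction on the degree splits off a real factor:
  a complex root \<open>z\<close> of \<open>q\<close> gives \<open>t - z\<close> if it is real, and \<open>(t - Re z)\<^sup>2 + (Im z)\<^sup>2\<close> if not.
  The operator of the linear factor is invertible because \<open>z\<close> is outside the spectrum, that
  of the quadratic factor because it is coercive.\<close>

lemma invertible_poly_op:
  assumes sa: "self_adjoint A"
  shows "q \<noteq> 0 \<Longrightarrow> (\<And>t. t \<in> real_spectrum A \<Longrightarrow> poly q t \<noteq> 0) \<Longrightarrow> invertible_op (poly_op q A)"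
proof (induction "degree q" arbitrary: q rule: less_induct)
  case less
  show ?case
  proof (cases "degree q = 0")
    case True
    then obtain a where "q = [:a:]" using degree_eq_zeroE by blast
    then show ?thesis using less.prems
      by (simp add: poly_op_const invertible_op_scaleR invertible_op_id)
  next
    case False
    have step: ?thesis if q: "q = d * r" and d: "degree d > 0" and inv: "invertible_op (poly_op d A)"
      for d r
    proof -
      have nz: "d \<noteq> 0" "r \<noteq> 0" using less.prems(1) q by auto
      then have "degree r < degree q" using q d by (simp add: degree_mult_eq)
      then have "invertible_op (poly_op r A)"
        using less.prems(2) q nz by (intro less.hyps) auto
      with inv show ?thesis by (simp add: q poly_op_mult invertible_op_compose)
    qed
    define ev where "ev p z = poly (map_poly complex_of_real p) z" for p z
    have ev_pCons: "ev (pCons a p) z = of_real a + z * ev p z" for a p z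
      by (simp add: ev_def map_poly_pCons)
    have ev_0: "ev 0 z = 0" for z by (simp add: ev_def)
    have ev_add: "ev (p + r) z = ev p z + ev r z" for p r z
      by (induction p r rule: poly_induct2) (simp_all add: ev_pCons ev_0 algebra_simps)
    have ev_smult: "ev (smult a p) z = of_real a * ev p z" for a p z
      by (induction p) (simp_all add: ev_pCons ev_0 algebra_simps)
    have ev_mult: "ev (p * r) z = ev p z * ev r z" for p r z
      by (induction p) (simp_all add: ev_pCons ev_0 ev_add ev_smult algebra_simps)
    have ev_real: "ev p (of_real t) = of_real (poly p t)" for p t
      by (induction p) (simp_all add: ev_pCons ev_0)
    have "degree (map_poly complex_of_real q) = degree q" by (rule degree_map_poly) simp
    then have "\<not> constant (poly (map_poly complex_of_real q))"
      using False by (simp add: constant_degree)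
    then obtain z where z: "ev q z = 0"
      using fundamental_theorem_of_algebra unfolding ev_def by blast
    show ?thesis
    proof (cases "Im z = 0")
      case True
      then have "z = of_real (Re z)" by (simp add: complex_eq_iff)
      then have root: "poly q (Re z) = 0" using z ev_real[of q "Re z"] by simp
      then obtain r where q: "q = [:- Re z, 1:] * r" by (metis poly_eq_0_iff_dvd dvdE)
      have "Re z \<notin> real_spectrum A" using root less.prems(2) by blast
      then have "invertible_op (poly_op [:- Re z, 1:] A)"
        by (simp add: real_spectrum_iff poly_op_linear)
      then show ?thesis using q by (intro step) auto
    next
      case False
      define a b where "a = Re z" and "b = Im z"
      define d where "d = [:-a, 1:] * [:-a, 1:] + [:b\<^sup>2:]"
      have d: "d = [:a\<^sup>2 + b\<^sup>2, -2 * a, 1:]" by (simp add: d_def power2_eq_square)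
      have "z = Complex a b" by (simp add: a_def b_def)
      then have dz: "ev d z = 0"
        by (simp add: d ev_pCons ev_0 complex_eq_iff power2_eq_square algebra_simps)
      \<comment> \<open>The remainder is \<open>u + v t\<close> with real \<open>u\<close>, \<open>v\<close> and vanishes at the nonreal \<open>z\<close>.\<close>
      have "degree (q mod d) < 2"
        using degree_mod_less[of d q] by (auto simp: d)
      then obtain u v where uv: "q mod d = [:u, v:]"
        by (metis (no_types, lifting) degree_pCons_eq degree_eq_zeroE less_2_cases pCons_cases
            One_nat_def Suc_inject pCons_0_0 degree_0)
      have "ev (q mod d) z = 0"
        using z dz ev_add[of "q div d * d" "q mod d" z] by (simp add: ev_mult)
      then have "of_real u + z * of_real v = 0" by (simp add: uv ev_pCons ev_0)
      then have "q mod d = 0" using False by (auto simp: uv complex_eq_iff)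
      then have q: "q = d * (q div d)" using mult_div_mod_eq[of d q] by simp
      have "invertible_op (poly_op d A)"
      proof (rule invertible_op_if_coercive)
        show "complex_linear (poly_op d A)"
          using self_adjoint_poly_op[OF sa] by (simp add: self_adjoint_def)
        show "b\<^sup>2 > 0" using False by (simp add: b_def)
        let ?B = "poly_op [:-a, 1:] A"
        have "rsym ?B" using self_adjoint_poly_op[OF sa] by (simp add: self_adjoint_def)
        then have "rinner x (?B (?B x)) = (norm (?B x))\<^sup>2" for x
          by (metis rsymD rinner_self)
        then show "b\<^sup>2 * (norm x)\<^sup>2 \<le> rinner x (poly_op d A x)" for x
          unfolding d_def poly_op_add poly_op_mult poly_op_const
          by (simp add: blinfun.add_left blinfun.scaleR_left rinner_simps rinner_self)
      qed
      then show ?thesis using q by (intro step) (auto simp: d)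
    qed
  qed
qed

text \<open>If the infimum \<open>m\<close> of the Rayleigh quotients were negative, \<open>A - m\<close> would be positive and
  invertible, hence coercive with some constant \<open>c > 0\<close>, and \<open>m + c\<close> would be a lower bound as well.\<close>

lemma form_nonneg_if_spectrum_nonneg:
  assumes "self_adjoint A" and sp: "\<And>t. t < 0 \<Longrightarrow> t \<notin> real_spectrum A"
  shows "form_nonneg A"
proof (rule ccontr)
  assume "\<not> form_nonneg A"
  then obtain x\<^sub>0 where x0: "rinner x\<^sub>0 (A x\<^sub>0) < 0" by (auto simp: form_nonneg_def not_le)
  then have "x\<^sub>0 \<noteq> 0" by (auto simp: blinfun.zero_right)
  define Q where "Q = (\<lambda>x. rinner x (A x) / (norm x)\<^sup>2) ` (- {0})"
  have bdd: "bdd_below Q"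
  proof (rule bdd_belowI)
    fix y assume "y \<in> Q"
    then obtain x where x: "x \<noteq> 0" "y = rinner x (A x) / (norm x)\<^sup>2" by (auto simp: Q_def)
    have "\<bar>rinner x (A x)\<bar> \<le> norm x * (norm A * norm x)"
      by (rule order_trans[OF rinner_Cauchy_Schwarz mult_left_mono[OF norm_blinfun]]) simp
    then have "- norm A * (norm x)\<^sup>2 \<le> rinner x (A x)"
      by (simp add: power2_eq_square algebra_simps)
    then show "- norm A \<le> y" unfolding x(2) using x(1) by (subst pos_le_divide_eq) simp_all
  qed
  define m where "m = Inf Q"
  have "m \<le> rinner x\<^sub>0 (A x\<^sub>0) / (norm x\<^sub>0)\<^sup>2"
    unfolding m_def using bdd \<open>x\<^sub>0 \<noteq> 0\<close> by (intro cInf_lower) (auto simp: Q_def)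
  also have "\<dots> < 0" using x0 \<open>x\<^sub>0 \<noteq> 0\<close> by (simp add: divide_neg_pos)
  finally have "m < 0" .
  have lower: "m * (norm x)\<^sup>2 \<le> rinner x (A x)" for x
  proof (cases "x = 0")
    case False
    then have "m \<le> rinner x (A x) / (norm x)\<^sup>2"
      unfolding m_def using bdd by (intro cInf_lower) (auto simp: Q_def)
    then show ?thesis using False by (simp add: field_simps)
  qed simp
  define C where "C = A - m *\<^sub>R id_blinfun"
  have C: "rinner x (C x) = rinner x (A x) - m * (norm x)\<^sup>2" for x
    by (simp add: C_def blinfun.diff_left blinfun.scaleR_left rinner_simps rinner_self)
  have "rsym C" using self_adjoint_diff[OF assms(1) self_adjoint_scaleR[OF self_adjoint_id]]
    by (simp add: C_def self_adjoint_def)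
  moreover have "form_nonneg C" using lower by (simp add: form_nonneg_def C)
  moreover have "invertible_op C" using sp[OF \<open>m < 0\<close>] by (simp add: C_def real_spectrum_iff)
  ultimately obtain c where c: "c > 0" "\<And>x. c * (norm x)\<^sup>2 \<le> rinner x (C x)"
    by (rule coercive_if_invertible) blast
  have "m + c \<le> Inf Q"
  proof (rule cInf_greatest)
    show "Q \<noteq> {}" using \<open>x\<^sub>0 \<noteq> 0\<close> by (auto simp: Q_def)
    fix y assume "y \<in> Q"
    then obtain x where x: "x \<noteq> 0" "y = rinner x (A x) / (norm x)\<^sup>2" by (auto simp: Q_def)
    show "m + c \<le> y"
      using c(2)[of x] x(1) unfolding C x(2) by (simp add: pos_le_divide_eq algebra_simps)
  qed
  with c(1) show False by (simp add: m_def)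
qed

text \<open>With an empty real spectrum every \<open>A - t\<close> would be positive, so \<open>\<langle>x, A x\<rangle>\<close> would exceed
  every multiple of \<open>\<parallel>x\<parallel>\<^sup>2\<close>. Thus only the zero space has operators of this kind. This is what
  excludes negative constant polynomials in the next lemma.\<close>

lemma real_spectrum_empty:
  fixes A :: "'a::complex_hilbert \<Rightarrow>\<^sub>L 'a" and x :: 'a
  assumes "self_adjoint A" "real_spectrum A = {}"
  shows "x = 0"
proof -
  have "t * (norm x)\<^sup>2 \<le> rinner x (A x)" for t
  proof -
    have "form_nonneg (A - t *\<^sub>R id_blinfun)"
    proof (rule form_nonneg_if_spectrum_nonneg)
      show "self_adjoint (A - t *\<^sub>R id_blinfun)"
        by (intro self_adjoint_diff assms(1) self_adjoint_scaleR self_adjoint_id)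
      show "s \<notin> real_spectrum (A - t *\<^sub>R id_blinfun)" for s
      proof -
        have "s + t \<notin> real_spectrum A" using assms(2) by simp
        then show ?thesis by (simp add: real_spectrum_iff scaleR_add_left algebra_simps)
      qed
    qed
    then have "0 \<le> rinner x ((A - t *\<^sub>R id_blinfun) x)" by (simp add: form_nonneg_def)
    then show ?thesis by (simp add: blinfun.diff_left blinfun.scaleR_left rinner_simps rinner_self)
  qed
  from this[of "(rinner x (A x) + 1) / (norm x)\<^sup>2"] show ?thesis by (cases "x = 0") auto
qed

text \<open>For \<open>s < 0\<close> the polynomial \<open>p - s\<close> has no zero in the spectrum of \<open>A\<close>, so no negative
  number is in the spectrum of \<open>p(A)\<close>.\<close>

lemma form_nonneg_poly_op:
  assumes sa: "self_adjoint A" and p: "\<And>t. t \<in> real_spectrum A \<Longrightarrow> 0 \<le> poly p t"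
  shows "form_nonneg (poly_op p A)"
proof (cases "real_spectrum A = {}")
  case True
  then show ?thesis using real_spectrum_empty[OF sa]
    by (metis form_nonneg_def order_refl rinner_zero_right)
next
  case False
  then obtain t\<^sub>0 where t0: "t\<^sub>0 \<in> real_spectrum A" by blast
  show ?thesis
  proof (rule form_nonneg_if_spectrum_nonneg)
    show "self_adjoint (poly_op p A)" using sa by (rule self_adjoint_poly_op)
    fix s :: real assume "s < 0"
    have pos: "poly (p - [:s:]) t \<noteq> 0" if "t \<in> real_spectrum A" for t
      using p[OF that] \<open>s < 0\<close> by simp
    have "p - [:s:] \<noteq> 0" using pos[OF t0] by auto
    then have "invertible_op (poly_op (p - [:s:]) A)"
      using pos by (intro invertible_poly_op sa)
    then show "s \<notin> real_spectrum (poly_op p A)"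
      by (simp add: real_spectrum_iff poly_op_diff poly_op_const)
  qed
qed

text \<open>Positivity of \<open>M\<^sup>2 - p(A)\<^sup>2\<close> says \<open>\<parallel>p(A) x\<parallel>\<^sup>2 \<le> M\<^sup>2 \<parallel>x\<parallel>\<^sup>2\<close>.\<close>

lemma norm_poly_op_le:
  assumes sa: "self_adjoint A" and "M \<ge> 0" and p: "\<And>t. t \<in> real_spectrum A \<Longrightarrow> \<bar>poly p t\<bar> \<le> M"
  shows "norm (poly_op p A) \<le> M"
proof (rule norm_blinfun_bound[OF \<open>M \<ge> 0\<close>])
  fix x
  have "form_nonneg (poly_op ([:M\<^sup>2:] - p * p) A)"
  proof (rule form_nonneg_poly_op[OF sa])
    fix t assume "t \<in> real_spectrum A"
    then have "\<bar>poly p t\<bar>\<^sup>2 \<le> M\<^sup>2" using p by (intro power_mono) auto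
    then show "0 \<le> poly ([:M\<^sup>2:] - p * p) t" by (simp add: power2_eq_square)
  qed
  then have "0 \<le> rinner x (poly_op ([:M\<^sup>2:] - p * p) A x)" by (simp add: form_nonneg_def)
  moreover have "rsym (poly_op p A)" using self_adjoint_poly_op[OF sa] by (simp add: self_adjoint_def)
  then have "rinner x (poly_op p A (poly_op p A x)) = (norm (poly_op p A x))\<^sup>2"
    by (metis rsymD rinner_self)
  ultimately have "(norm (poly_op p A x))\<^sup>2 \<le> (M * norm x)\<^sup>2"
    by (simp add: poly_op_diff poly_op_mult poly_op_const blinfun.diff_left blinfun.scaleR_left
        rinner_simps rinner_self power_mult_distrib)
  then show "norm (poly_op p A x) \<le> M * norm x"
    by (rule power2_le_imp_le) (simp add: \<open>M \<ge> 0\<close>)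
qed

section \<open>The continuous functional calculus\<close>

lemma poly_op_diff_tendsto_0:
  assumes sa: "self_adjoint A"
    and p: "uniform_limit (real_spectrum A) (\<lambda>n. poly (p n)) f sequentially"
    and q: "uniform_limit (real_spectrum A) (\<lambda>n. poly (q n)) f sequentially"
  shows "(\<lambda>n. poly_op (p n) A - poly_op (q n) A) \<longlonglongrightarrow> 0"
proof (rule LIMSEQ_I)
  fix e :: real assume e: "e > 0"
  have "\<forall>\<^sub>F n in sequentially. \<forall>t\<in>real_spectrum A. \<bar>poly (p n) t - poly (q n) t\<bar> < e / 2"
    using uniform_limitD[OF uniform_limit_minus[OF p q], of "e / 2"] e by (simp add: dist_real_def)
  then obtain N where N: "\<And>n t. n \<ge> N \<Longrightarrow> t \<in> real_spectrum A \<Longrightarrow> \<bar>poly (p n - q n) t\<bar> < e / 2"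
    by (auto simp: eventually_sequentially)
  have "norm (poly_op (p n - q n) A) \<le> e / 2" if "n \<ge> N" for n
    using N[OF that] e by (intro norm_poly_op_le sa) (auto intro: less_imp_le)
  then show "\<exists>N. \<forall>n\<ge>N. norm (poly_op (p n) A - poly_op (q n) A - 0) < e"
    using e by (intro exI[of _ N]) (force simp: poly_op_diff)
qed

text \<open>The norm bound makes \<open>p\<^sub>n(A)\<close> a Cauchy sequence and any two approximating sequences
  equivalent. This resolves the definite description in the definition of \<open>cfc\<close>.\<close>

lemma poly_op_tendsto_cfc:
  assumes sa: "self_adjoint A"
    and p: "uniform_limit (real_spectrum A) (\<lambda>n. poly (p n)) f sequentially"
  shows "(\<lambda>n. poly_op (p n) A) \<longlonglongrightarrow> cfc f A"
proof -
  have "Cauchy (\<lambda>n. poly_op (p n) A)"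
  proof (rule metric_CauchyI)
    fix e :: real assume e: "e > 0"
    have "uniformly_Cauchy_on (real_spectrum A) (\<lambda>n. poly (p n))"
      using p by (blast intro: uniformly_convergent_Cauchy uniformly_convergentI)
    then obtain N where N: "\<And>m n t. m \<ge> N \<Longrightarrow> n \<ge> N \<Longrightarrow> t \<in> real_spectrum A \<Longrightarrow>
        \<bar>poly (p m - p n) t\<bar> < e / 2"
      using half_gt_zero[OF e] unfolding uniformly_Cauchy_on_def dist_real_def poly_diff by meson
    have "norm (poly_op (p m - p n) A) \<le> e / 2" if "m \<ge> N" "n \<ge> N" for m n
      using N[OF that] e by (intro norm_poly_op_le sa) (auto intro: less_imp_le)
    then show "\<exists>N. \<forall>m\<ge>N. \<forall>n\<ge>N. dist (poly_op (p m) A) (poly_op (p n) A) < e"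
      using e by (intro exI[of _ N]) (force simp: dist_norm poly_op_diff)
  qed
  then obtain B where B: "(\<lambda>n. poly_op (p n) A) \<longlonglongrightarrow> B"
    using Cauchy_convergent convergent_def by blast
  have "cfc f A = B"
    unfolding cfc_def real_spectrum_def[symmetric]
  proof (rule the_equality)
    fix C assume "\<exists>q. uniform_limit (real_spectrum A) (\<lambda>n. poly (q n)) f sequentially \<and>
      (\<lambda>n. poly_op (q n) A) \<longlonglongrightarrow> C"
    then obtain q where q: "uniform_limit (real_spectrum A) (\<lambda>n. poly (q n)) f sequentially"
      and C: "(\<lambda>n. poly_op (q n) A) \<longlonglongrightarrow> C" by blast
    have "C - B = 0"
      by (rule LIMSEQ_unique[OF tendsto_diff[OF C B] poly_op_diff_tendsto_0[OF sa q p]])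
    then show "C = B" by simp
  qed (use p B in blast)
  with B show ?thesis by simp
qed

definition approximable :: "(real \<Rightarrow> real) \<Rightarrow> ('a::complex_hilbert \<Rightarrow>\<^sub>L 'a) \<Rightarrow> bool"
  where "approximable f A \<longleftrightarrow>
    (\<exists>p. uniform_limit (real_spectrum A) (\<lambda>n. poly (p n)) f sequentially)"

text \<open>Weierstrass approximation takes place on an interval around the spectrum, so that the
  spectrum does not have to be shown compact.\<close>

lemma approximable_continuous:
  assumes "real_spectrum A \<subseteq> {a..b}" "continuous_on {a..b} f"
  shows "approximable f A"
proof -
  obtain g where g: "uniform_limit {a..b} g f sequentially" "\<And>n. polynomial_function (g n)"
    using Stone_Weierstrass_uniform_limit[OF compact_Icc assms(2)] by blast
  have "\<exists>p. g n = poly p" for n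
  proof -
    obtain c N where "g n = (\<lambda>x. \<Sum>i\<le>N. c i * x ^ i)"
      using g(2)[of n] by (auto simp: real_polynomial_function_iff_sum simp flip: real_polynomial_function_eq)
    then have "g n = poly (\<Sum>i\<le>N. monom (c i) i)" by (auto simp: poly_sum poly_monom)
    then show ?thesis ..
  qed
  then obtain p where "\<And>n. g n = poly (p n)" by metis
  then have "g = (\<lambda>n. poly (p n))" by blast
  with g(1) have "uniform_limit {a..b} (\<lambda>n. poly (p n)) f sequentially" by simp
  then show ?thesis using assms(1) by (auto simp: approximable_def intro: uniform_limit_on_subset)
qed

lemma self_adjoint_cfc:
  assumes "self_adjoint A" "approximable f A"
  shows "self_adjoint (cfc f A)"
  using assms self_adjoint_limit[OF self_adjoint_poly_op poly_op_tendsto_cfc]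
  by (auto simp: approximable_def)

lemma cfc_cong:
  assumes "\<And>t. t \<in> real_spectrum A \<Longrightarrow> f t = g t"
  shows "cfc f A = cfc g A"
proof -
  have "uniform_limit (real_spectrum A) (\<lambda>n. poly (p n)) f sequentially \<longleftrightarrow>
    uniform_limit (real_spectrum A) (\<lambda>n. poly (p n)) g sequentially" for p
    using assms by (intro uniform_limit_cong') auto
  then show ?thesis by (simp add: cfc_def real_spectrum_def[symmetric])
qed

lemma cfc_poly:
  assumes "self_adjoint A"
  shows "cfc (poly p) A = poly_op p A"
proof -
  have "(\<lambda>n. poly_op p A) \<longlonglongrightarrow> cfc (poly p) A"
    by (rule poly_op_tendsto_cfc[OF assms]) (rule uniform_limit_const)
  then show ?thesis by (simp add: LIMSEQ_const_iff)
qed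

lemma cfc_add:
  assumes sa: "self_adjoint A" and "approximable f A" "approximable g A"
  shows "cfc (\<lambda>t. f t + g t) A = cfc f A + cfc g A"
proof -
  obtain p q where p: "uniform_limit (real_spectrum A) (\<lambda>n. poly (p n)) f sequentially"
    and q: "uniform_limit (real_spectrum A) (\<lambda>n. poly (q n)) g sequentially"
    using assms by (auto simp: approximable_def)
  have "uniform_limit (real_spectrum A) (\<lambda>n. poly (p n + q n)) (\<lambda>t. f t + g t) sequentially"
    unfolding poly_add by (rule uniform_limit_add[OF p q])
  then have "(\<lambda>n. poly_op (p n + q n) A) \<longlonglongrightarrow> cfc (\<lambda>t. f t + g t) A"
    by (rule poly_op_tendsto_cfc[OF sa])
  moreover have "(\<lambda>n. poly_op (p n + q n) A) \<longlonglongrightarrow> cfc f A + cfc g A"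
    unfolding poly_op_add by (intro tendsto_add poly_op_tendsto_cfc sa p q)
  ultimately show ?thesis by (rule LIMSEQ_unique)
qed

lemma cfc_mult:
  assumes sa: "self_adjoint A" and "approximable f A" "approximable g A"
    and bdd: "bounded (f ` real_spectrum A)" "bounded (g ` real_spectrum A)"
  shows "cfc (\<lambda>t. f t * g t) A = cfc f A o\<^sub>L cfc g A"
proof -
  obtain p q where p: "uniform_limit (real_spectrum A) (\<lambda>n. poly (p n)) f sequentially"
    and q: "uniform_limit (real_spectrum A) (\<lambda>n. poly (q n)) g sequentially"
    using assms by (auto simp: approximable_def)
  have "uniform_limit (real_spectrum A) (\<lambda>n. poly (p n * q n)) (\<lambda>t. f t * g t) sequentially"
    unfolding poly_mult
    by (rule bounded_bilinear.bounded_uniform_limit[OF bounded_bilinear_mult p q bdd(2,1)])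
  then have "(\<lambda>n. poly_op (p n * q n) A) \<longlonglongrightarrow> cfc (\<lambda>t. f t * g t) A"
    by (rule poly_op_tendsto_cfc[OF sa])
  moreover have "(\<lambda>n. poly_op (p n * q n) A) \<longlonglongrightarrow> (cfc f A o\<^sub>L cfc g A)"
    unfolding poly_op_mult
    by (rule bounded_bilinear.tendsto[OF bounded_bilinear_blinfun_compose
      poly_op_tendsto_cfc[OF sa p] poly_op_tendsto_cfc[OF sa q]])
  ultimately show ?thesis by (rule LIMSEQ_unique)
qed

text \<open>The approximating polynomials need not be nonnegative on the spectrum, but they become so
  after adding a small constant \<open>d\<close>.\<close>

lemma form_nonneg_cfc:
  fixes A :: "'a::complex_hilbert \<Rightarrow>\<^sub>L 'a"
  assumes sa: "self_adjoint A" and "approximable f A"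
    and nonneg: "\<And>t. t \<in> real_spectrum A \<Longrightarrow> 0 \<le> f t"
  shows "form_nonneg (cfc f A)"
  unfolding form_nonneg_def
proof (rule allI, rule field_le_epsilon)
  fix x :: 'a and e :: real assume e: "e > 0"
  obtain p where p: "uniform_limit (real_spectrum A) (\<lambda>n. poly (p n)) f sequentially"
    using assms by (auto simp: approximable_def)
  define d where "d = e / ((norm x)\<^sup>2 + 1)"
  have n: "(norm x)\<^sup>2 + 1 > 0" by (simp add: add_nonneg_pos)
  have d: "d > 0" "d * (norm x)\<^sup>2 \<le> e"
    using e n by (simp_all add: d_def pos_divide_le_eq[OF n] distrib_left)
  have "\<forall>\<^sub>F n in sequentially. \<forall>t\<in>real_spectrum A. dist (poly (p n) t) (f t) < d"
    using p d(1) by (rule uniform_limitD)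
  then have "\<forall>\<^sub>F n in sequentially. - e \<le> rinner x (poly_op (p n) A x)"
  proof eventually_elim
    case (elim n)
    have "form_nonneg (poly_op (p n + [:d:]) A)"
      using elim nonneg by (intro form_nonneg_poly_op sa) (force simp: dist_real_def)
    then have "0 \<le> rinner x (poly_op (p n + [:d:]) A x)" by (simp add: form_nonneg_def)
    then have "0 \<le> rinner x (poly_op (p n) A x) + d * (norm x)\<^sup>2"
      by (simp add: poly_op_add poly_op_const blinfun.add_left blinfun.scaleR_left rinner_simps
          rinner_self)
    with d(2) show ?case by linarith
  qed
  moreover have "(\<lambda>n. rinner x (poly_op (p n) A x)) \<longlonglongrightarrow> rinner x (cfc f A x)"
    by (intro tendsto_rinner tendsto_const bounded_bilinear.tendsto[OF bounded_bilinear_blinfun_apply]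
      poly_op_tendsto_cfc sa p)
  ultimately have "- e \<le> rinner x (cfc f A x)"
    by (intro tendsto_lowerbound) auto
  then show "0 \<le> rinner x (cfc f A x) + e" by simp
qed

section \<open>The operator inequality\<close>

lemma op_sqrt_square:
  assumes "positive_op A"
  shows "self_adjoint (op_sqrt A)" "op_sqrt A o\<^sub>L op_sqrt A = A"
proof -
  have sa: "self_adjoint A" and nn: "form_nonneg A"
    using assms by (simp_all add: positive_op_iff self_adjoint_def)
  have sp: "real_spectrum A \<subseteq> {0..norm A}"
    using real_spectrum_ge[OF sa, of 0] real_spectrum_le_norm[OF sa] nn
    by (auto simp: form_nonneg_def)
  have cont: "continuous_on {0..norm A} sqrt" by (intro continuous_intros)
  have app: "approximable sqrt A" using sp cont by (rule approximable_continuous)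
  then show "self_adjoint (op_sqrt A)" using sa by (intro self_adjoint_cfc)
  have bdd: "bounded (sqrt ` real_spectrum A)"
    using compact_imp_bounded[OF compact_continuous_image[OF cont compact_Icc]] sp
    by (meson bounded_subset image_mono)
  have "op_sqrt A o\<^sub>L op_sqrt A = cfc (\<lambda>t. sqrt t * sqrt t) A"
    by (rule cfc_mult[symmetric]) (intro sa app bdd)+
  also have "\<dots> = cfc (poly [:0, 1:]) A"
    using sp by (intro cfc_cong) auto
  also have "\<dots> = A" by (simp add: cfc_poly[OF sa] poly_op_linear)
  finally show "op_sqrt A o\<^sub>L op_sqrt A = A" .
qed

text \<open>Strict positivity confines the spectrum to an interval \<open>[c, \<parallel>T\<parallel>]\<close> with \<open>c > 0\<close>. There both
  \<open>ln\<close> and \<open>inverse\<close> are continuous, the latter represents \<open>T\<^bsup>-1\<^esup>\<close>, and the scalar inequality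
  \<open>ln t - 1 + 1 / t \<ge> 0\<close> carries over.\<close>

lemma op_log_lower_bound:
  assumes "strictly_positive_op T"
  shows "self_adjoint (op_log T)" "form_nonneg (op_log T - id_blinfun + op_inverse T)"
proof -
  have sa: "self_adjoint T" and nn: "form_nonneg T" and inv: "invertible_op T"
    using assms by (simp_all add: strictly_positive_op_def positive_op_iff self_adjoint_def)
  obtain c where c: "c > 0" "\<And>x. c * (norm x)\<^sup>2 \<le> rinner x (T x)"
    using coercive_if_invertible[of T] sa nn inv by (auto simp: self_adjoint_def)
  have sp: "real_spectrum T \<subseteq> {c..norm T}"
    using real_spectrum_ge[OF sa c(2)] real_spectrum_le_norm[OF sa] by auto
  have app: "approximable f T" if "continuous_on {c..norm T} f" for f
    using sp that by (rule approximable_continuous)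
  have bdd: "bounded (f ` real_spectrum T)" if "continuous_on {c..norm T} f" for f
    using compact_imp_bounded[OF compact_continuous_image[OF that compact_Icc]] sp
    by (meson bounded_subset image_mono)
  have ln: "continuous_on {c..norm T} ln" using c(1) by (intro continuous_intros) auto
  have inverse: "continuous_on {c..norm T} inverse" using c(1) by (intro continuous_intros) auto
  have poly: "continuous_on {c..norm T} (poly p)" for p by (intro continuous_intros)
  show "self_adjoint (op_log T)" by (intro self_adjoint_cfc sa app ln)
  have X: "cfc (poly [:0, 1:]) T = T" by (simp add: cfc_poly[OF sa] poly_op_linear)
  have one: "cfc (poly 1) T = id_blinfun"
    unfolding one_pCons by (simp add: cfc_poly[OF sa] poly_op_const)
  have nz: "t \<noteq> 0" if "t \<in> real_spectrum T" for t
    using that sp c(1) by fastforce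
  have "T o\<^sub>L cfc inverse T = cfc (\<lambda>t. poly [:0, 1:] t * inverse t) T"
    using cfc_mult[OF sa app[OF poly] app[OF inverse] bdd[OF poly] bdd[OF inverse]]
    by (metis X)
  also have "\<dots> = cfc (poly 1) T" using nz by (intro cfc_cong) simp
  finally have TI: "T o\<^sub>L cfc inverse T = id_blinfun" by (simp add: one)
  have "cfc inverse T o\<^sub>L T = cfc (\<lambda>t. inverse t * poly [:0, 1:] t) T"
    using cfc_mult[OF sa app[OF inverse] app[OF poly] bdd[OF inverse] bdd[OF poly]]
    by (metis X)
  also have "\<dots> = cfc (poly 1) T" using nz by (intro cfc_cong) simp
  finally have IT: "cfc inverse T o\<^sub>L T = id_blinfun" by (simp add: one)
  have I: "op_inverse T = cfc inverse T"
    using sa TI IT by (intro op_inverse_eqI is_op_inverseI) (simp add: self_adjoint_def)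
  have m1: "cfc (poly [:-1:]) T = - id_blinfun"
    by (simp add: cfc_poly[OF sa] poly_op_const)
  have "cfc (\<lambda>t. (ln t + poly [:-1:] t) + inverse t) T =
      cfc (\<lambda>t. ln t + poly [:-1:] t) T + cfc inverse T"
    by (rule cfc_add[OF sa app[OF continuous_on_add[OF ln poly]] app[OF inverse]])
  also have "cfc (\<lambda>t. ln t + poly [:-1:] t) T = op_log T + cfc (poly [:-1:]) T"
    by (rule cfc_add[OF sa app[OF ln] app[OF poly]])
  finally have "op_log T - id_blinfun + op_inverse T =
      cfc (\<lambda>t. (ln t + poly [:-1:] t) + inverse t) T"
    by (simp only: I m1 add_uminus_conv_diff)
  moreover have "form_nonneg (cfc (\<lambda>t. (ln t + poly [:-1:] t) + inverse t) T)"
  proof (rule form_nonneg_cfc[OF sa])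
    show "approximable (\<lambda>t. (ln t + poly [:-1:] t) + inverse t) T"
      by (intro app continuous_on_add ln poly inverse)
    fix t assume "t \<in> real_spectrum T"
    then have "t > 0" using sp c(1) by force
    then have "ln (inverse t) \<le> inverse t - 1" by (intro ln_le_minus_one) simp
    then show "0 \<le> (ln t + poly [:-1:] t) + inverse t" using \<open>t > 0\<close> by (simp add: ln_inverse)
  qed
  ultimately show "form_nonneg (op_log T - id_blinfun + op_inverse T)" by simp
qed

text \<open>Conjugation of the bound for \<open>log T\<close> by \<open>S = R\<^bsup>1/2\<^esup>\<close>, written out on vectors: the form of
  \<open>log T - 1 + T\<^bsup>-1\<^esup>\<close> at \<open>S x\<close> is the form of the difference of the two sides at \<open>x\<close>.\<close>

lemma diff_le_relative_entropy:
  assumes "strictly_positive_op L" "strictly_positive_op R"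
  shows "R - L \<le>\<^sub>o\<^sub>p op_sqrt R o\<^sub>L op_log (op_sqrt R o\<^sub>L op_inverse L o\<^sub>L op_sqrt R) o\<^sub>L op_sqrt R"
proof -
  have L: "self_adjoint L" "form_nonneg L" "invertible_op L"
    and R: "self_adjoint R" "positive_op R" "invertible_op R"
    using assms by (simp_all add: strictly_positive_op_def positive_op_iff self_adjoint_def)
  define S where "S = op_sqrt R"
  have S: "self_adjoint S" and SS: "S o\<^sub>L S = R"
    using op_sqrt_square[OF R(2)] by (simp_all add: S_def)
  define Li where "Li = op_inverse L"
  have Li: "is_op_inverse L Li"
    unfolding Li_def using L(3) by (rule is_op_inverse_op_inverse)
  obtain Ri where Ri: "is_op_inverse R Ri" using R(3) by (auto simp: invertible_op_def)
  have SSx: "R x = S (S x)" for x by (simp flip: SS)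
  have SR: "S (S (Ri x)) = x" "Ri (S (S x)) = x" for x
    using is_op_inverse_apply[OF Ri] by (simp_all add: SSx)
  have comm: "S (Ri x) = Ri (S x)" for x
    by (metis SR)
  \<comment> \<open>\<open>S\<close> is invertible because its square is: \<open>S R\<^bsup>-1\<^esup>\<close> is a right inverse, and a left inverse
    since \<open>S\<close> commutes with \<open>R\<^bsup>-1\<^esup>\<close>.\<close>
  define Si where "Si = S o\<^sub>L Ri"
  have Si: "is_op_inverse S Si"
    using S by (intro is_op_inverseI blinfun_eqI) (simp_all add: Si_def self_adjoint_def SR comm)
  have cl: "complex_linear L" "complex_linear S" using L(1) S by (simp_all add: self_adjoint_def)
  define T where "T = S o\<^sub>L Li o\<^sub>L S"
  have symL: "rinner (L x) y = rinner x (L y)" and symS: "rinner (S x) y = rinner x (S y)" for x y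
    using L(1) S by (simp_all add: self_adjoint_def rsym_def)
  have LLi: "L (Li x) = x" for x using Li by (rule is_op_inverse_apply)
  have "rinner (Li x) y = rinner x (Li y)" for x y
    using symL[of "Li x" "Li y"] by (simp add: LLi)
  then have "rsym Li" by (simp add: rsym_def)
  then have "self_adjoint Li" using Li by (simp add: self_adjoint_def is_op_inverse_def)
  then have T: "self_adjoint T" unfolding T_def using S by (intro self_adjoint_sandwich)
  have posLi: "0 \<le> rinner x (Li x)" for x
    using L(2) LLi[of x] rinner_commute[of "Li x" x] unfolding form_nonneg_def by metis
  have "form_nonneg T"
    using posLi by (simp add: form_nonneg_def T_def flip: symS)
  have Ti: "is_op_inverse T (Si o\<^sub>L (L o\<^sub>L Si))"
    unfolding T_def 
    by (intro is_op_inverse_compose is_op_inverse_sym[OF cl(1) Li] Si)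
  then have "strictly_positive_op T"
    using T \<open>form_nonneg T\<close>
    by (auto simp: strictly_positive_op_def positive_op_iff self_adjoint_def invertible_op_def)
  then have log: "self_adjoint (op_log T)" "form_nonneg (op_log T - id_blinfun + op_inverse T)"
    by (rule op_log_lower_bound)+
  have inv: "op_inverse T = Si o\<^sub>L (L o\<^sub>L Si)" using Ti by (rule op_inverse_eqI)
  define D where "D = (S o\<^sub>L op_log T o\<^sub>L S) - (R - L)"
  have "self_adjoint D"
    unfolding D_def using log S R L by (intro self_adjoint_diff self_adjoint_sandwich)
  moreover have "form_nonneg D"
    unfolding form_nonneg_def
  proof
    fix x
    have "0 \<le> rinner (S x) ((op_log T - id_blinfun + op_inverse T) (S x))"
      using log(2) by (simp add: form_nonneg_def)
    also have "\<dots> = rinner (S x) (op_log T (S x)) - rinner (S x) (S x) + rinner (S x) (Si (L x))"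
      by (simp add: inv blinfun.add_left blinfun.diff_left rinner_simps is_op_inverse_apply[OF Si])
    also have "\<dots> = rinner x (D x)"
      by (simp add: D_def blinfun.diff_left rinner_simps SSx symS is_op_inverse_apply[OF Si])
    finally show "0 \<le> rinner x (D x)" .
  qed
  ultimately show ?thesis
    by (simp add: op_le_def positive_op_iff self_adjoint_def D_def T_def S_def Li_def)
qed

lemma op_le_sum:
  assumes "\<And>i. i \<in> I \<Longrightarrow> X i \<le>\<^sub>o\<^sub>p Y i"
  shows "(\<Sum>i\<in>I. X i) \<le>\<^sub>o\<^sub>p (\<Sum>i\<in>I. Y i)"
proof -
  have "(\<Sum>i\<in>I. Y i) - (\<Sum>i\<in>I. X i) = (\<Sum>i\<in>I. Y i - X i)" by (simp add: sum_subtractf)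
  moreover have "positive_op (\<Sum>i\<in>I. Y i - X i)" using assms
  proof (induction I rule: infinite_finite_induct)
    case (insert i I)
    then show ?case
      by (auto simp: op_le_def positive_op_iff complex_linear_add rsym_def form_nonneg_def
          blinfun.add_left rinner_simps)
  qed (use self_adjoint_poly_op[OF self_adjoint_id, of 0] in
      \<open>simp_all add: positive_op_iff self_adjoint_def form_nonneg_def\<close>)
  ultimately show ?thesis by (simp add: op_le_def)
qed

theorem mainTheorem7:
  fixes L R :: "nat \<Rightarrow> 'a::complex_hilbert \<Rightarrow>\<^sub>L 'a" and n :: nat
  assumes "\<And>i. i \<in> {1..n} \<Longrightarrow> strictly_positive_op (L i)"
    and "\<And>i. i \<in> {1..n} \<Longrightarrow> strictly_positive_op (R i)"
  shows "(\<Sum>i=1..n. R i - L i) \<le>\<^sub>o\<^sub>p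
    (\<Sum>i=1..n. op_sqrt (R i) o\<^sub>L
      op_log (op_sqrt (R i) o\<^sub>L op_inverse (L i) o\<^sub>L op_sqrt (R i)) o\<^sub>L op_sqrt (R i))"
  using assms by (intro op_le_sum diff_le_relative_entropy)

end
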